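(* Let $\ell\ge 1$ and let $A=(a_1,\ldots,a_\ell)$ and $B=(b_1,\ldots,b_\ell)$ be two words in $\{\mathrm{H},\mathrm{T}\}^\ell$ such that $\mathrm{Cor}(A,A)=\mathrm{Cor}(B,B)$ (equivalently $[A,A]=[B,B]$). For $n\ge 1$, let $X_n=(\varepsilon_1,\ldots,\varepsilon_n)$ where, under $\mathbb{P}_n$, the letters $\varepsilon_i$ are i.i.d. uniformly distributed on $\{\mathrm{H},\mathrm{T}\}$. Then for every $n\ge 1$, the random pairs $(N_A(X_n),N_B(X_n))$ and $(N_B(X_n),N_A(X_n))$ have the same distribution. In particular, for every $n\ge1$, $$\mathbb{P}_n\big(N_B(X_n)>N_A(X_n)\big)=\mathbb{P}_n\big(N_A(X_n)>N_B(X_n)\big).$$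
   Context: A word of length $\ell$ is a sequence in $\{\mathrm{H},\mathrm{T}\}^\ell$. For a word $A=(a_1,\ldots,a_\ell)$ and a sequence $X_n=(\varepsilon_k)_{1\le k\le n}\in\{\mathrm{H},\mathrm{T}\}^n$, the number of (possibly overlapping) occurrences of $A$ in $X_n$ is $N_A(X_n)=|\{\ell\le k\le n:\ (\varepsilon_{k-\ell+1},\ldots,\varepsilon_k)=(a_1,\ldots,a_\ell)\}|$. For two words $A,B$ of length $\ell$, $\mathrm{Cor}(A,B)=\{1\le k\le \ell-1:\ (a_{\ell-k+1},\ldots,a_\ell)=(b_1,\ldots,b_k)\}$ and $[A,B]=\sum_{k\in\mathrm{Cor}(A,B)}2^k$; $[A,A]$ is the auto-correlation of $A$. *)

theory Defs
  imports "HOL-Probability.Probability"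
begin

datatype letter = H | T

text \<open>Words and finite sequences are lists, so the \<open>i\<close>-th letter (counted from 1) of \<open>A\<close> is
  \<open>A ! (i - 1)\<close>. The occurrences of \<open>A\<close> in \<open>X\<close> are indexed by the (1-based) position \<open>k\<close> of
  their last letter; the factor of \<open>X\<close> at positions \<open>k - l + 1, ..., k\<close>, where \<open>l = length A\<close>,
  is \<open>take l (drop (k - l) X)\<close>.\<close>

definition occ_count :: "letter list \<Rightarrow> letter list \<Rightarrow> nat" where
  "occ_count A X =
     card {k. length A \<le> k \<and> k \<le> length X \<and> take (length A) (drop (k - length A) X) = A}"

text \<open>Both words are meant to have the same length: \<open>k\<close> belongs to \<open>Cor A B\<close> iff the last
  \<open>k\<close> letters of \<open>A\<close> are the first \<open>k\<close> letters of \<open>B\<close>.\<close>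

definition Cor :: "letter list \<Rightarrow> letter list \<Rightarrow> nat set" where
  "Cor A B = {k. 1 \<le> k \<and> k \<le> length A - 1 \<and> drop (length A - k) A = take k B}"

definition correlation :: "letter list \<Rightarrow> letter list \<Rightarrow> nat" where
  "correlation A B = (\<Sum>k\<in>Cor A B. 2 ^ k)"

definition sample :: "(nat \<Rightarrow> 'a \<Rightarrow> letter) \<Rightarrow> nat \<Rightarrow> 'a \<Rightarrow> letter list" where
  "sample \<epsilon> n \<omega> = map (\<lambda>k. \<epsilon> k \<omega>) [1..<n + 1]"

end

theory Submission
  imports Defs "HOL-Library.Nat_Bijection"
begin

text \<open>Mark some occurrences of \<open>A\<close> and of \<open>B\<close> in a sequence of length \<open>n\<close>. The number of
  sequences that realise prescribed marks is \<open>2 ^ (n - c)\<close>, with \<open>c\<close> the number of covered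
  positions, if any two overlapping marks agree on their overlap, and \<open>0\<close> otherwise. Reflect the
  starting points of the marks by \<open>p \<mapsto> n - l - p\<close> and exchange the two labels: an \<open>A\<close> followed by
  a \<open>B\<close> turns into an \<open>A\<close> followed by a \<open>B\<close> with the same overlap, and an \<open>A\<close> followed by an \<open>A\<close>
  turns into a \<open>B\<close> followed by a \<open>B\<close>, so agreement is preserved because \<open>A\<close> and \<open>B\<close> have the same
  self-overlaps. Hence the mixed binomial moments of \<open>(N_A, N_B)\<close> are symmetric, and they
  determine the distribution.\<close>

section \<open>Sequences with prescribed letters\<close>

instance letter :: finite
proof
  have "(UNIV :: letter set) = {H, T}"
    using letter.exhaust by auto
  then show "finite (UNIV :: letter set)"
    by (metis finite.emptyI finite.insertI)
qed

lemma card_letter: "CARD(letter) = 2"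
proof -
  have "(UNIV :: letter set) = {H, T}"
    using letter.exhaust by auto
  then have "CARD(letter) = card {H, T}" by (simp only:)
  then show ?thesis by simp
qed

lemma card_lists_nth_in:
  fixes D :: "nat \<Rightarrow> 'a set"
  shows "card {X. length X = n \<and> (\<forall>i<n. X ! i \<in> D i)} = (\<Prod>i<n. card (D i))"
proof -
  have "bij_betw (\<lambda>f. map f [0..<n]) (PiE {..<n} D)
      {X. length X = n \<and> (\<forall>i<n. X ! i \<in> D i)}"
  proof (rule bij_betw_byWitness[where f' = "\<lambda>X. \<lambda>i\<in>{..<n}. X ! i"])
    show "\<forall>f\<in>PiE {..<n} D. (\<lambda>i\<in>{..<n}. map f [0..<n] ! i) = f"
      by (auto simp: fun_eq_iff PiE_def extensional_def restrict_def)
    show "\<forall>X\<in>{X. length X = n \<and> (\<forall>i<n. X ! i \<in> D i)}. map (\<lambda>i\<in>{..<n}. X ! i) [0..<n] = X"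
      by (auto intro!: nth_equalityI)
    show "(\<lambda>f. map f [0..<n]) ` PiE {..<n} D \<subseteq> {X. length X = n \<and> (\<forall>i<n. X ! i \<in> D i)}"
      by (intro image_subsetI CollectI conjI) (simp_all add: PiE_mem)
    show "(\<lambda>X. \<lambda>i\<in>{..<n}. X ! i) ` {X. length X = n \<and> (\<forall>i<n. X ! i \<in> D i)} \<subseteq> PiE {..<n} D"
      by (intro image_subsetI PiE_I) simp_all
  qed
  from bij_betw_same_card[OF this] show ?thesis
    by (simp add: card_PiE)
qed

text \<open>Each pair in \<open>R\<close> forces one letter at one position. Two pairs with the same
  position and different letters exclude every list; otherwise the positions in
  \<open>Domain R\<close> are forced and the other ones are free.\<close>

lemma card_lists_prescribed:
  fixes R :: "(nat \<times> 'a::finite) set"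
  assumes "Domain R \<subseteq> {..<n}"
  shows "card {X. length X = n \<and> (\<forall>(i, c)\<in>R. X ! i = c)} =
    (if single_valued R then CARD('a) ^ (n - card (Domain R)) else 0)"
proof (cases "single_valued R")
  case True
  \<comment> \<open>\<open>D i\<close> is the set of letters allowed at position \<open>i\<close>;
    single-valuedness makes it a singleton on \<open>Domain R\<close>.\<close>
  define D where "D i = (if i \<in> Domain R then R `` {i} else UNIV)" for i
  have "{X. length X = n \<and> (\<forall>(i, c)\<in>R. X ! i = c)} =
      {X. length X = n \<and> (\<forall>i<n. X ! i \<in> D i)}"
  proof (intro Collect_cong conj_cong refl iffI)
    fix X :: "'a list"
    assume "\<forall>(i, c)\<in>R. X ! i = c"
    then show "\<forall>i<n. X ! i \<in> D i"
      by (force simp: D_def)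
  next
    fix X :: "'a list"
    assume *: "\<forall>i<n. X ! i \<in> D i"
    have "X ! i = c" if "(i, c) \<in> R" for i c
    proof -
      have "i < n" "i \<in> Domain R" using that assms by auto
      with *[rule_format, of i] have "(i, X ! i) \<in> R" by (simp add: D_def)
      with that True show ?thesis by (auto dest: single_valuedD)
    qed
    then show "\<forall>(i, c)\<in>R. X ! i = c" by auto
  qed
  moreover have "card (D i) = (if i \<in> Domain R then 1 else CARD('a))" for i
  proof (cases "i \<in> Domain R")
    case inR: True
    then obtain c where "(i, c) \<in> R" by auto
    with True have "R `` {i} = {c}" by (auto dest: single_valuedD)
    with inR show ?thesis by (simp add: D_def)
  qed (simp add: D_def)
  moreover have "(\<Prod>i<n. if i \<in> Domain R then 1 else CARD('a)) = CARD('a) ^ (n - card (Domain R))"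
  proof -
    have "(\<Prod>i<n. if i \<in> Domain R then 1 else CARD('a)) = (\<Prod>i\<in>{..<n} - Domain R. CARD('a))"
      by (rule prod.mono_neutral_cong_right) auto
    also have "\<dots> = CARD('a) ^ (n - card (Domain R))"
      using assms by (simp add: card_Diff_subset finite_subset[OF assms])
    finally show ?thesis .
  qed
  ultimately show ?thesis
    using True by (simp add: card_lists_nth_in)
next
  case False
  then obtain i c d where *: "(i, c) \<in> R" "(i, d) \<in> R" "c \<noteq> d"
    by (auto simp: single_valued_def)
  have none: "{X. length X = n \<and> (\<forall>(i, c)\<in>R. X ! i = c)} = {}"
  proof (intro equals0I)
    fix X assume "X \<in> {X. length X = n \<and> (\<forall>(i, c)\<in>R. X ! i = c)}"
    then have "X ! i = c" "X ! i = d" using *(1,2) by auto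
    with *(3) show False by simp
  qed
  show ?thesis
    unfolding none using False by simp
qed

section \<open>Marked occurrences\<close>

text \<open>Occurrences are located by their 0-based starting point, because it is the starting
  points that are reflected later.\<close>

definition occ :: "'a list \<Rightarrow> 'a list \<Rightarrow> nat set" where
  "occ A X = {p. p + length A \<le> length X \<and> take (length A) (drop p X) = A}"

text \<open>The 1-based position of the last letter is the 0-based starting point plus
  \<open>length A\<close>, so the two index sets differ by a shift.\<close>

lemma occ_count_eq: "occ_count A X = card (occ A X)"
  unfolding occ_count_def
proof (rule bij_betw_same_card[where f = "\<lambda>k. k - length A"], rule bij_betw_byWitness)
  show "\<forall>p\<in>occ A X. p + length A - length A = p" by simp
qed (auto simp: occ_def)

lemma occ_subset: "length X = n \<Longrightarrow> occ A X \<subseteq> {..n - length A}"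
  by (auto simp: occ_def)

lemma mem_occ_iff:
  assumes "p + length A \<le> length X"
  shows "p \<in> occ A X \<longleftrightarrow> (\<forall>i<length A. X ! (p + i) = A ! i)"
  using assms by (auto simp: occ_def list_eq_iff_nth_eq[of _ A])

text \<open>A relation rather than a function, so that copies of words that clash on an overlap show
  up as a failure of \<open>single_valued\<close>.\<close>

definition marks :: "'a list \<Rightarrow> nat set \<Rightarrow> (nat \<times> 'a) set" where
  "marks A S = {(p + i, A ! i) | p i. p \<in> S \<and> i < length A}"

lemma marksI: "p \<in> S \<Longrightarrow> i < length A \<Longrightarrow> (p + i, A ! i) \<in> marks A S"
  unfolding marks_def by blast

lemma subset_occ_iff:
  assumes "length X = n" "length A \<le> n" "S \<subseteq> {..n - length A}"
  shows "S \<subseteq> occ A X \<longleftrightarrow> (\<forall>(i, c)\<in>marks A S. X ! i = c)"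
proof -
  have "p + length A \<le> length X" if "p \<in> S" for p
    using that assms by (auto simp: le_diff_conv2 dest!: subsetD)
  then have "S \<subseteq> occ A X \<longleftrightarrow> (\<forall>p\<in>S. \<forall>i<length A. X ! (p + i) = A ! i)"
    by (auto simp: mem_occ_iff subset_iff)
  also have "\<dots> \<longleftrightarrow> (\<forall>(i, c)\<in>marks A S. X ! i = c)"
    unfolding marks_def by fastforce
  finally show ?thesis .
qed

text \<open>Reduces the count to two data of the marks, consistency and the number of covered
  positions; these are what the reflection has to preserve.\<close>

lemma card_marked:
  fixes A B :: "'a::finite list"
  assumes "length A = l" "length B = l" "l \<le> n" "S \<subseteq> {..n - l}" "U \<subseteq> {..n - l}"
  shows "card {X. length X = n \<and> S \<subseteq> occ A X \<and> U \<subseteq> occ B X} =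
    (if single_valued (marks A S \<union> marks B U)
     then CARD('a) ^ (n - card (Domain (marks A S \<union> marks B U))) else 0)"
proof -
  have "{X. length X = n \<and> S \<subseteq> occ A X \<and> U \<subseteq> occ B X} =
      {X. length X = n \<and> (\<forall>(i, c)\<in>marks A S \<union> marks B U. X ! i = c)}"
    using assms
    by (intro Collect_cong conj_cong refl) (simp add: subset_occ_iff[of _ n] ball_Un)
  moreover have "Domain (marks A S \<union> marks B U) \<subseteq> {..<n}"
    using assms by (fastforce simp: marks_def)
  ultimately show ?thesis
    by (simp add: card_lists_prescribed)
qed

section \<open>Reflection of the marks\<close>

text \<open>A border of length \<open>length A - d\<close> is the same thing as a period
  \<open>d\<close>, that is, agreement of \<open>A\<close> with its shift by
  \<open>d\<close>.\<close>

lemma mem_Cor_self_iff: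
  assumes "1 \<le> d" "d < length A"
  shows "length A - d \<in> Cor A A \<longleftrightarrow> (\<forall>j. j + d < length A \<longrightarrow> A ! (j + d) = A ! j)"
  using assms by (auto simp: Cor_def list_eq_iff_nth_eq[of "drop _ _"] add.commute less_diff_conv)

text \<open>Whether two copies of one word starting at \<open>p\<close> and \<open>q\<close> agree
  depends only on the distance of \<open>p\<close> and \<open>q\<close>, and for each proper overlap
  the answer is recorded in the self-correlation set, which the two words share.\<close>

lemma self_overlap_transfer:
  assumes "length A = length B" "Cor A A = Cor B B"
    and A: "\<And>i j. i < length A \<Longrightarrow> j < length A \<Longrightarrow> p + i = q + j \<Longrightarrow> A ! i = A ! j"
    and "i < length B" "j < length B" "p + i = q + j"
  shows "B ! i = B ! j"
  using A assms(4-)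
proof (induction p q arbitrary: i j rule: linorder_wlog)
  case (le p q)
  define d where "d = q - p"
  have i: "i = j + d" using le by (simp add: d_def)
  show ?case
  \<comment> \<open>Shift 0 stands apart since \<open>Cor\<close> records only overlaps shorter than
    the word; in that case \<open>i = j\<close>.\<close>
  proof (cases "d = 0")
    case False
    have "A ! (j + d) = A ! j" if "j + d < length A" for j
      using le(2)[of "j + d" j] le(1) that by (simp add: d_def)
    moreover have d: "1 \<le> d" "d < length A" "d < length B"
      using False i le assms(1) by auto
    ultimately have "length A - d \<in> Cor B B"
      using assms(2) mem_Cor_self_iff[of d A] by simp
    then have "length B - d \<in> Cor B B"
      using assms(1) by simp
    then show ?thesis
      using mem_Cor_self_iff[of d B] d i le by simp
  qed (simp add: i)
next
  case (sym p q)
  have "B ! j = B ! i"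
  proof (rule sym(1))
    show "A ! i = A ! j" if "i < length A" "j < length A" "q + i = p + j" for i j
      using sym(2)[of j i] that by simp
  qed (use sym in simp_all)
  then show ?case by simp
qed

lemma single_valued_reflected_marks:
  assumes "length A = l" "length B = l" "Cor A A = Cor B B"
    and "S \<subseteq> {..m}" "U \<subseteq> {..m}"
    and sv: "single_valued (marks A S \<union> marks B U)"
  shows "single_valued (marks A ((-) m ` U) \<union> marks B ((-) m ` S))"
proof -
  \<comment> \<open>A mixed overlap is reflected to a mixed overlap with the same offsets in
    \<open>A\<close> and in \<open>B\<close>, so it is governed by the given consistency
    directly.\<close>
  have cross: "A ! i = B ! j" if "p \<in> S" "q \<in> U" "i < l" "j < l" "p + i = q + j" for p q i j
  proof -
    have "(p + i, A ! i) \<in> marks A S" "(q + j, B ! j) \<in> marks B U"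
      using marksI[of p S i A] marksI[of q U j B] that assms(1,2) by simp_all
    then show ?thesis using sv that(5) by (auto dest: single_valuedD)
  qed
  have AA: "A ! i = A ! j" if "p \<in> S" "q \<in> S" "i < l" "j < l" "p + i = q + j" for p q i j
  proof -
    have "(p + i, A ! i) \<in> marks A S" "(q + j, A ! j) \<in> marks A S"
      using marksI[of p S i A] marksI[of q S j A] that assms(1) by simp_all
    then show ?thesis using sv that(5) by (auto dest: single_valuedD)
  qed
  have BB: "B ! i = B ! j" if "p \<in> U" "q \<in> U" "i < l" "j < l" "p + i = q + j" for p q i j
  proof -
    have "(p + i, B ! i) \<in> marks B U" "(q + j, B ! j) \<in> marks B U"
      using marksI[of p U i B] marksI[of q U j B] that assms(2) by simp_all
    then show ?thesis using sv that(5) by (auto dest: single_valuedD)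
  qed
  \<comment> \<open>Exchanging the labels turns overlaps of two copies of \<open>A\<close> into
    overlaps of two copies of \<open>B\<close> and conversely; here the equality of the
    \<open>Cor\<close> sets enters.\<close>
  have BB': "B ! i = B ! j" if "p \<in> S" "q \<in> S" "i < l" "j < l" "p + i = q + j" for p q i j
    using self_overlap_transfer[of A B p q i j] AA[of p q] that assms by simp
  have AA': "A ! i = A ! j" if "p \<in> U" "q \<in> U" "i < l" "j < l" "p + i = q + j" for p q i j
    using self_overlap_transfer[of B A p q i j] BB[of p q] that assms by simp
  \<comment> \<open>Reflecting the starting points swaps the offsets at which the two copies meet.
    The bounds by \<open>m\<close> keep the subtraction on \<open>nat\<close> from
    truncating.\<close>
  have refl: "p + j = q + i" if "m - p + i = m - q + j" "p \<le> m" "q \<le> m" for p q i j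
    using that by linarith
  have le: "p \<le> m" if "p \<in> S \<union> U" for p
    using that assms(4,5) by auto
  have mem: "\<exists>p i. p \<in> V \<and> i < l \<and> k = m - p + i \<and> c = W ! i"
    if "(k, c) \<in> marks W ((-) m ` V)" "length W = l" for k c W V
    using that by (auto simp: marks_def)
  show ?thesis
  proof (rule single_valuedI)
    fix k c d
    assume "(k, c) \<in> marks A ((-) m ` U) \<union> marks B ((-) m ` S)"
      and "(k, d) \<in> marks A ((-) m ` U) \<union> marks B ((-) m ` S)"
    then show "c = d"
    proof (elim UnE)
      assume "(k, c) \<in> marks A ((-) m ` U)" "(k, d) \<in> marks A ((-) m ` U)"
      from mem[OF this(1) assms(1)] mem[OF this(2) assms(1)]
      obtain p i q j where "p \<in> U" "i < l" "k = m - p + i" "c = A ! i"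
        "q \<in> U" "j < l" "k = m - q + j" "d = A ! j"
        by metis
      then show ?thesis
        using AA'[of p q j i] refl[of p i q j] le[of p] le[of q] by simp
    next
      assume "(k, c) \<in> marks B ((-) m ` S)" "(k, d) \<in> marks A ((-) m ` U)"
      from mem[OF this(1) assms(2)] mem[OF this(2) assms(1)]
      obtain p i q j where "p \<in> S" "i < l" "k = m - p + i" "c = B ! i"
        "q \<in> U" "j < l" "k = m - q + j" "d = A ! j"
        by metis
      then show ?thesis
        using cross[of p q j i] refl[of p i q j] le[of p] le[of q] by simp
    next
      assume "(k, c) \<in> marks A ((-) m ` U)" "(k, d) \<in> marks B ((-) m ` S)"
      from mem[OF this(1) assms(1)] mem[OF this(2) assms(2)]
      obtain p i q j where "p \<in> U" "i < l" "k = m - p + i" "c = A ! i"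
        "q \<in> S" "j < l" "k = m - q + j" "d = B ! j"
        by metis
      then show ?thesis
        using cross[of q p i j] refl[of p i q j] le[of p] le[of q] by simp
    next
      assume "(k, c) \<in> marks B ((-) m ` S)" "(k, d) \<in> marks B ((-) m ` S)"
      from mem[OF this(1) assms(2)] mem[OF this(2) assms(2)]
      obtain p i q j where "p \<in> S" "i < l" "k = m - p + i" "c = B ! i"
        "q \<in> S" "j < l" "k = m - q + j" "d = B ! j"
        by metis
      then show ?thesis
        using BB'[of p q j i] refl[of p i q j] le[of p] le[of q] by simp
    qed
  qed
qed

lemma reflect_reflect: "S \<subseteq> {..m::nat} \<Longrightarrow> (-) m ` ((-) m ` S) = S"
  by (force simp: image_image image_def)

text \<open>Reflection with exchange of labels is an involution, so the implication already shown
  yields its own converse.\<close>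

lemma single_valued_reflected_marks_iff:
  assumes "length A = l" "length B = l" "Cor A A = Cor B B"
    and "S \<subseteq> {..m}" "U \<subseteq> {..m}"
  shows "single_valued (marks A ((-) m ` U) \<union> marks B ((-) m ` S)) \<longleftrightarrow>
    single_valued (marks A S \<union> marks B U)"
proof
  assume "single_valued (marks A ((-) m ` U) \<union> marks B ((-) m ` S))"
  then have "single_valued (marks A ((-) m ` ((-) m ` S)) \<union> marks B ((-) m ` ((-) m ` U)))"
    by (intro single_valued_reflected_marks[OF assms(1-3), of "(-) m ` U" m "(-) m ` S"]) auto
  then show "single_valued (marks A S \<union> marks B U)"
    using assms by (simp add: reflect_reflect)
qed (rule single_valued_reflected_marks[OF assms])

lemma Domain_marks: "Domain (marks A S) = (\<Union>p\<in>S. {p..<p + length A})"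
proof -
  have "{p..<p + length A} = (+) p ` {..<length A}" for p
    using image_add_atLeastLessThan[of p 0 "length A"] by (simp add: atLeast0LessThan add.commute)
  then show ?thesis
    by (auto simp: marks_def)
qed

text \<open>Reflecting the starting point of a block of length \<open>l\<close> amounts to reversing
  all positions \<open>0, ..., n - 1\<close>.\<close>

lemma reflect_interval:
  fixes p l n :: nat
  assumes "p + l \<le> n"
  shows "{n - l - p..<n - l - p + l} = (\<lambda>i. n - 1 - i) ` {p..<p + l}"
proof (intro equalityI subsetI)
  fix x assume "x \<in> {n - l - p..<n - l - p + l}"
  then show "x \<in> (\<lambda>i. n - 1 - i) ` {p..<p + l}"
    using assms by (intro image_eqI[of _ _ "n - 1 - x"]) auto
qed (use assms in auto)

text \<open>Both words have length \<open>l\<close>, so the covered set ignores the labels; it is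
  mirrored by the reversal of positions.\<close>

lemma card_Domain_reflected_marks:
  assumes "length A = l" "length B = l" "l \<le> n" "S \<subseteq> {..n - l}" "U \<subseteq> {..n - l}"
  shows "card (Domain (marks A ((-) (n - l) ` U) \<union> marks B ((-) (n - l) ` S))) =
    card (Domain (marks A S \<union> marks B U))"
proof -
  have cov: "Domain (marks A S \<union> marks B U) = (\<Union>p\<in>S \<union> U. {p..<p + l})" for S U
    using assms(1,2) by (simp add: Domain_Un_eq Domain_marks UN_Un)
  have le: "p + l \<le> n" if "p \<in> S \<union> U" for p
    using that assms(3-5) by (auto simp: le_diff_conv2 dest!: subsetD)
  have "Domain (marks A ((-) (n - l) ` U) \<union> marks B ((-) (n - l) ` S)) =
      (\<Union>p\<in>S \<union> U. {n - l - p..<n - l - p + l})"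
    unfolding cov by auto
  also have "\<dots> = (\<Union>p\<in>S \<union> U. (\<lambda>i. n - 1 - i) ` {p..<p + l})"
    using le by (intro SUP_cong refl reflect_interval)
  also have "\<dots> = (\<lambda>i. n - 1 - i) ` Domain (marks A S \<union> marks B U)"
    by (simp only: cov image_UN)
  also have "card \<dots> = card (Domain (marks A S \<union> marks B U))"
  proof (rule card_image, rule inj_onI)
    fix x y
    assume x: "x \<in> Domain (marks A S \<union> marks B U)" and y: "y \<in> Domain (marks A S \<union> marks B U)"
      and eq: "n - 1 - x = n - 1 - y"
    from x obtain p where "p \<in> S \<union> U" "x \<in> {p..<p + l}"
      unfolding cov by (rule UN_E)
    moreover from y obtain q where "q \<in> S \<union> U" "y \<in> {q..<q + l}"
      unfolding cov by (rule UN_E)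
    \<comment> \<open>The truncated map \<open>n - 1 - x\<close> is injective only on positions
      below \<open>n\<close>.\<close>
    ultimately have "x \<le> n - 1" "y \<le> n - 1"
      using le[of p] le[of q] by auto
    with eq show "x = y" by (metis diff_diff_cancel)
  qed
  finally show ?thesis .
qed

lemma card_marked_reflect:
  fixes A B :: "letter list"
  assumes "length A = l" "length B = l" "l \<le> n" "S \<subseteq> {..n - l}" "U \<subseteq> {..n - l}"
    and "Cor A A = Cor B B"
  shows "card {X. length X = n \<and> (-) (n - l) ` U \<subseteq> occ A X \<and> (-) (n - l) ` S \<subseteq> occ B X} =
    card {X. length X = n \<and> S \<subseteq> occ A X \<and> U \<subseteq> occ B X}"
proof -
  have "(-) (n - l) ` U \<subseteq> {..n - l}" "(-) (n - l) ` S \<subseteq> {..n - l}" by auto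
  then show ?thesis
    using assms
    by (simp only: card_marked single_valued_reflected_marks_iff[OF assms(1,2,6,4,5)]
        card_Domain_reflected_marks[OF assms(1-5)])
qed

section \<open>Binomial moments\<close>

text \<open>Double counting: the binomials count the ways to mark \<open>i\<close> elements of
  \<open>P X\<close> and \<open>j\<close> of \<open>Q X\<close>. The common superset
  \<open>V\<close> makes the range of the marks independent of \<open>X\<close>, so the sums can be
  exchanged.\<close>

lemma sum_choose_mult_choose:
  assumes "finite \<Omega>" "finite V" "\<And>X. X \<in> \<Omega> \<Longrightarrow> P X \<subseteq> V" "\<And>X. X \<in> \<Omega> \<Longrightarrow> Q X \<subseteq> V"
  shows "(\<Sum>X\<in>\<Omega>. (card (P X) choose i) * (card (Q X) choose j)) =
    (\<Sum>S | S \<subseteq> V \<and> card S = i. \<Sum>U | U \<subseteq> V \<and> card U = j.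
      card {X \<in> \<Omega>. S \<subseteq> P X \<and> U \<subseteq> Q X})"
proof -
  define sub where "sub i = {S. S \<subseteq> V \<and> card S = i}" for i
  have fin: "finite (sub i)" for i
    using assms(2) by (simp add: sub_def)
  have ch: "(card W choose i) = (\<Sum>S\<in>sub i. of_bool (S \<subseteq> W))" if "W \<subseteq> V" for W i
  proof -
    have "(card W choose i) = card {S. S \<subseteq> W \<and> card S = i}"
      using n_subsets[of W i] assms(2) that finite_subset by metis
    also have "{S. S \<subseteq> W \<and> card S = i} = {S \<in> sub i. S \<subseteq> W}"
      using that by (auto simp: sub_def)
    also have "card \<dots> = (\<Sum>S\<in>sub i. of_bool (S \<subseteq> W))"
      using fin[of i] by (simp add: Int_def)
    finally show ?thesis .
  qed
  have "(\<Sum>X\<in>\<Omega>. (card (P X) choose i) * (card (Q X) choose j)) =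
      (\<Sum>X\<in>\<Omega>. \<Sum>S\<in>sub i. \<Sum>U\<in>sub j. of_bool (S \<subseteq> P X \<and> U \<subseteq> Q X))"
    using assms(3,4) by (intro sum.cong refl) (simp add: ch sum_product of_bool_conj)
  also have "\<dots> = (\<Sum>S\<in>sub i. \<Sum>X\<in>\<Omega>. \<Sum>U\<in>sub j. of_bool (S \<subseteq> P X \<and> U \<subseteq> Q X))"
    by (rule sum.swap)
  also have "\<dots> = (\<Sum>S\<in>sub i. \<Sum>U\<in>sub j. \<Sum>X\<in>\<Omega>. of_bool (S \<subseteq> P X \<and> U \<subseteq> Q X))"
    by (intro sum.cong refl sum.swap)
  also have "\<dots> = (\<Sum>S\<in>sub i. \<Sum>U\<in>sub j. card {X \<in> \<Omega>. S \<subseteq> P X \<and> U \<subseteq> Q X})"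
    using assms(1) by (simp add: Int_def)
  finally show ?thesis by (simp add: sub_def)
qed

text \<open>The matrix of binomials \<open>a choose i\<close> is triangular with unit diagonal.
  Going down from \<open>N\<close>, the moment of order \<open>a\<close> loses its terms below
  \<open>a\<close> by the vanishing binomial and those above \<open>a\<close> by induction.\<close>

lemma binomial_moments_zero:
  fixes d :: "nat \<Rightarrow> int"
  assumes moments: "\<And>i. (\<Sum>a\<le>N. d a * int (a choose i)) = 0" and "a \<le> N"
  shows "d a = 0"
  using assms(2)
proof (induction "N - a" arbitrary: a rule: less_induct)
  case less
  have "(\<Sum>b\<le>N. d b * int (b choose a)) = (\<Sum>b\<in>{a}. d b * int (b choose a))"
  proof (rule sum.mono_neutral_right)
    show "\<forall>b\<in>{..N} - {a}. d b * int (b choose a) = 0"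
    proof
      fix b assume b: "b \<in> {..N} - {a}"
      show "d b * int (b choose a) = 0"
      proof (cases "b < a")
        case False
        then have "d b = 0" using b less(2) by (intro less(1)) auto
        then show ?thesis by simp
      qed (simp add: binomial_eq_0)
    qed
  qed (use less in auto)
  then show ?case using moments[of a] by simp
qed

text \<open>Mixed binomial moments determine a joint distribution on a bounded range: the
  one-variable inversion is applied to each coordinate in turn.\<close>

lemma card_eq_if_binomial_moments_eq:
  fixes f g f' g' :: "'b \<Rightarrow> nat"
  assumes "finite \<Omega>"
    and moments: "\<And>i j. (\<Sum>X\<in>\<Omega>. (f X choose i) * (g X choose j)) =
      (\<Sum>X\<in>\<Omega>. (f' X choose i) * (g' X choose j))"
  shows "card {X \<in> \<Omega>. f X = a \<and> g X = b} = card {X \<in> \<Omega>. f' X = a \<and> g' X = b}"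
proof -
  \<comment> \<open>One bound for all values of the four functions and for the prescribed
    \<open>a\<close> and \<open>b\<close>.\<close>
  define N where "N = a + b + (\<Sum>X\<in>\<Omega>. f X + g X + f' X + g' X)"
  have bound: "f X \<le> N" "g X \<le> N" "f' X \<le> N" "g' X \<le> N" if "X \<in> \<Omega>" for X
    using member_le_sum[of X \<Omega> "\<lambda>X. f X + g X + f' X + g' X"] that assms(1)
    by (auto simp: N_def)
  define c where "c a b = int (card {X \<in> \<Omega>. f X = a \<and> g X = b}) -
    int (card {X \<in> \<Omega>. f' X = a \<and> g' X = b})" for a b
  have group: "(\<Sum>a\<le>N. \<Sum>b\<le>N. int (card {X \<in> \<Omega>. u X = a \<and> v X = b}) * (int (a choose i) * int (b choose j))) =
      int (\<Sum>X\<in>\<Omega>. (u X choose i) * (v X choose j))"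
    if "\<And>X. X \<in> \<Omega> \<Longrightarrow> u X \<le> N" "\<And>X. X \<in> \<Omega> \<Longrightarrow> v X \<le> N" for u v i j
  proof -
    have "(\<Sum>X\<in>\<Omega>. (u X choose i) * (v X choose j)) =
        (\<Sum>z\<in>{..N} \<times> {..N}. \<Sum>X | X \<in> \<Omega> \<and> (u X, v X) = z. (u X choose i) * (v X choose j))"
      using that assms(1) by (intro sum.group[symmetric]) auto
    also have "\<dots> = (\<Sum>z\<in>{..N} \<times> {..N}.
        card {X \<in> \<Omega>. u X = fst z \<and> v X = snd z} * ((fst z choose i) * (snd z choose j)))"
    proof (intro sum.cong refl)
      fix z
      have "(\<Sum>X | X \<in> \<Omega> \<and> (u X, v X) = z. (u X choose i) * (v X choose j)) =
          (\<Sum>X | X \<in> \<Omega> \<and> u X = fst z \<and> v X = snd z. (fst z choose i) * (snd z choose j))"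
        by (intro sum.cong) auto
      then show "(\<Sum>X | X \<in> \<Omega> \<and> (u X, v X) = z. (u X choose i) * (v X choose j)) =
          card {X \<in> \<Omega>. u X = fst z \<and> v X = snd z} * ((fst z choose i) * (snd z choose j))"
        by simp
    qed
    finally show ?thesis
      by (simp add: sum.cartesian_product case_prod_beta)
  qed
  have "(\<Sum>a\<le>N. \<Sum>b\<le>N. c a b * (int (a choose i) * int (b choose j))) = 0" for i j
    using group[of f g i j] group[of f' g' i j] bound moments[of i j]
    by (simp add: c_def left_diff_distrib sum_subtractf)
  \<comment> \<open>For fixed \<open>j\<close> the inner sum is a function of \<open>a\<close> alone
    whose binomial moments vanish; inverting in \<open>a\<close> leaves the same situation in
    \<open>b\<close>.\<close>
  then have "(\<Sum>a\<le>N. (\<Sum>b\<le>N. c a b * int (b choose j)) * int (a choose i)) = 0" for i j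
    by (simp add: sum_distrib_left sum_distrib_right mult_ac)
  then have "(\<Sum>b\<le>N. c a b * int (b choose j)) = 0" for j
    by (rule binomial_moments_zero) (simp add: N_def)
  then have "c a b = 0"
    by (rule binomial_moments_zero) (simp add: N_def)
  then show ?thesis by (simp add: c_def)
qed

lemma bij_betw_reflect_subsets:
  "bij_betw ((`) ((-) m)) {S. S \<subseteq> {..m::nat} \<and> card S = i} {S. S \<subseteq> {..m} \<and> card S = i}"
proof (rule bij_betw_byWitness[where f' = "(`) ((-) m)"])
  have "card ((-) m ` S) = card S" if "S \<subseteq> {..m}" for S
    using that by (intro card_image inj_onI) (metis atMost_iff diff_diff_cancel subsetD)
  then show "(`) ((-) m) ` {S. S \<subseteq> {..m} \<and> card S = i} \<subseteq> {S. S \<subseteq> {..m} \<and> card S = i}"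
    and "(`) ((-) m) ` {S. S \<subseteq> {..m} \<and> card S = i} \<subseteq> {S. S \<subseteq> {..m} \<and> card S = i}"
    by auto
qed (simp_all add: reflect_reflect)

lemma finite_letter_lists: "finite {X :: letter list. length X = n}"
  using finite_lists_length_eq[of "UNIV :: letter set" n] by simp

text \<open>Each moment is a sum over pairs of mark sets of given sizes; reflection with exchange of
  labels keeps the summands and swaps the two sizes.\<close>

lemma occ_moments_symmetric:
  fixes A B :: "letter list"
  assumes "length A = l" "length B = l" "l \<le> n" "Cor A A = Cor B B"
  shows "(\<Sum>X | length X = n. (card (occ A X) choose i) * (card (occ B X) choose j)) =
    (\<Sum>X | length X = n. (card (occ B X) choose i) * (card (occ A X) choose j))"
proof -
  define m where "m = n - l"
  define sub where "sub i = {S. S \<subseteq> {..m} \<and> card S = i}" for i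
  define F where "F S U = card {X :: letter list. length X = n \<and> S \<subseteq> occ A X \<and> U \<subseteq> occ B X}" for S U
  have expand: "(\<Sum>X | length X = n. (card (occ A X) choose i) * (card (occ B X) choose j)) =
      (\<Sum>S\<in>sub i. \<Sum>U\<in>sub j. F S U)" for i j
    unfolding F_def sub_def
    by (subst sum_choose_mult_choose[OF finite_letter_lists, of "{..m}"])
       (use occ_subset[of _ n A] occ_subset[of _ n B] assms in \<open>auto simp: m_def\<close>)
  have bij: "bij_betw ((`) ((-) m)) (sub i) (sub i)" for i
    unfolding sub_def by (rule bij_betw_reflect_subsets)
  have "(\<Sum>S\<in>sub i. \<Sum>U\<in>sub j. F S U) = (\<Sum>S\<in>sub i. \<Sum>U\<in>sub j. F ((-) m ` U) ((-) m ` S))"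
    using card_marked_reflect[OF assms(1-3) _ _ assms(4)]
    by (intro sum.cong refl) (simp add: F_def sub_def m_def)
  \<comment> \<open>Reflection permutes the subsets of each size, so it can be absorbed into the
    summation variables.\<close>
  also have "\<dots> = (\<Sum>S\<in>sub i. \<Sum>U\<in>sub j. F U S)"
    by (simp add: sum.reindex_bij_betw[OF bij, of "\<lambda>U. F U _"]
        sum.reindex_bij_betw[OF bij, of "\<lambda>S. \<Sum>U\<in>sub j. F U S"])
  also have "\<dots> = (\<Sum>U\<in>sub j. \<Sum>S\<in>sub i. F U S)"
    by (rule sum.swap)
  finally show ?thesis
    by (simp add: expand[symmetric] mult.commute)
qed

lemma card_occ_count_symmetric:
  fixes A B :: "letter list"
  assumes "length A = l" "length B = l" "Cor A A = Cor B B"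
  shows "card {X. length X = n \<and> occ_count A X = a \<and> occ_count B X = b} =
    card {X. length X = n \<and> occ_count B X = a \<and> occ_count A X = b}"
proof (cases "l \<le> n")
  case True
  show ?thesis
    using card_eq_if_binomial_moments_eq[OF finite_letter_lists
        occ_moments_symmetric[OF assms(1,2) True assms(3)]]
    by (simp add: occ_count_eq)
next
  case False
  \<comment> \<open>Words longer than the sequence never occur, so both counts are 0.\<close>
  then have "occ_count A X = 0" "occ_count B X = 0" if "length X = n" for X
    using that assms by (auto simp: occ_count_def)
  then show ?thesis by (metis (lifting))
qed

section \<open>Distribution of the sample\<close>

text \<open>The correlation is the number whose binary digits describe \<open>Cor A A\<close>, and
  binary expansions are unique.\<close>

lemma Cor_eq_iff_correlation_eq: "Cor A A = Cor B B \<longleftrightarrow> correlation A A = correlation B B"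
proof -
  have "finite (Cor A A)" for A
    by (rule finite_subset[of _ "{..length A}"]) (auto simp: Cor_def)
  moreover have "correlation A A = set_encode (Cor A A)" for A
    by (simp add: correlation_def set_encode_def)
  ultimately show ?thesis by (simp add: set_encode_eq)
qed

lemma length_sample: "length (sample \<epsilon> n \<omega>) = n"
  by (simp add: sample_def)

lemma sample_eq_iff:
  assumes "length x = n"
  shows "sample \<epsilon> n \<omega> = x \<longleftrightarrow> (\<forall>i\<in>{1..n}. \<epsilon> i \<omega> = x ! (i - 1))"
proof
  assume "sample \<epsilon> n \<omega> = x"
  then show "\<forall>i\<in>{1..n}. \<epsilon> i \<omega> = x ! (i - 1)"
    by (auto simp: sample_def simp del: upt_Suc)
next
  assume *: "\<forall>i\<in>{1..n}. \<epsilon> i \<omega> = x ! (i - 1)"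
  show "sample \<epsilon> n \<omega> = x"
    using assms *[THEN bspec, of "Suc _"]
    by (intro nth_equalityI) (auto simp: sample_def simp del: upt_Suc)
qed

context prob_space
begin

lemma sample_measurable:
  assumes "\<And>i. i \<in> {1..n} \<Longrightarrow> \<epsilon> i \<in> measurable M (count_space UNIV)"
  shows "sample \<epsilon> n \<in> measurable M (count_space UNIV)"
proof -
  have "sample \<epsilon> n -` {x} \<inter> space M \<in> events" for x
  proof (cases "length x = n")
    case True
    have "sample \<epsilon> n -` {x} \<inter> space M = {\<omega> \<in> space M. \<forall>i\<in>{1..n}. \<epsilon> i \<omega> = x ! (i - 1)}"
      using True by (auto simp: sample_eq_iff)
    also have "\<dots> \<in> events"
    proof (rule sets.sets_Collect_finite_All)
      fix i assume "i \<in> {1..n}"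
      then show "{\<omega> \<in> space M. \<epsilon> i \<omega> = x ! (i - 1)} \<in> events"
        using measurable_sets[OF assms, of i "{x ! (i - 1)}"]
        by (simp add: vimage_def Int_def conj_commute)
    qed auto
    finally show ?thesis .
  next
    case False
    then have "sample \<epsilon> n -` {x} \<inter> space M = {}"
      by (auto simp: length_sample)
    then show ?thesis by simp
  qed
  \<comment> \<open>With the finite codomain of lists of length \<open>n\<close>, measurability can
    be tested on singletons; the codomain is enlarged to all lists afterwards.\<close>
  then have "sample \<epsilon> n \<in> measurable M (count_space {X. length X = n})"
    by (intro measurable_count_space_eq2[THEN iffD2] finite_letter_lists)
       (auto simp: length_sample)
  then show ?thesis
    by (auto intro: measurable_compose[where g = "\<lambda>x. x"])
qed

lemma prob_sample_eq:
  assumes "n \<ge> 1" "length x = n"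
    and indep: "indep_vars (\<lambda>_. count_space UNIV) \<epsilon> {1..n}"
    and unif: "\<And>i. i \<in> {1..n} \<Longrightarrow> distr M (count_space UNIV) (\<epsilon> i) = uniform_count_measure UNIV"
  shows "prob (sample \<epsilon> n -` {x} \<inter> space M) = (1 / 2) ^ n"
proof -
  have meas: "\<epsilon> i \<in> measurable M (count_space UNIV)" if "i \<in> {1..n}" for i
    using indep that by (auto simp: indep_vars_def2)
  \<comment> \<open>Since \<open>n \<ge> 1\<close>, the intersection is over a nonempty index set
    and stays inside \<open>space M\<close>.\<close>
  have "sample \<epsilon> n -` {x} \<inter> space M = (\<Inter>i\<in>{1..n}. \<epsilon> i -` {x ! (i - 1)} \<inter> space M)"
    using assms(1,2) by (auto simp: sample_eq_iff)
  also have "prob \<dots> = (\<Prod>i\<in>{1..n}. prob (\<epsilon> i -` {x ! (i - 1)} \<inter> space M))"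
    using assms(1) by (intro indep_varsD[OF indep]) auto
  also have "\<dots> = (\<Prod>i\<in>{1..n}. 1 / 2)"
  proof (rule prod.cong)
    fix i assume i: "i \<in> {1..n}"
    have "prob (\<epsilon> i -` {x ! (i - 1)} \<inter> space M) =
        measure (distr M (count_space UNIV) (\<epsilon> i)) {x ! (i - 1)}"
      using meas[OF i] by (simp add: measure_distr)
    also have "\<dots> = 1 / 2"
      by (simp add: unif[OF i] measure_uniform_count_measure card_letter)
    finally show "prob (\<epsilon> i -` {x ! (i - 1)} \<inter> space M) = 1 / 2" .
  qed simp
  finally show ?thesis by simp
qed

text \<open>Turns probabilities into counting: the event splits into finitely many disjoint
  equiprobable atoms, one for each list of length \<open>n\<close> in \<open>E\<close>.\<close>

lemma prob_sample_in:
  assumes "n \<ge> 1"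
    and indep: "indep_vars (\<lambda>_. count_space UNIV) \<epsilon> {1..n}"
    and unif: "\<And>i. i \<in> {1..n} \<Longrightarrow> distr M (count_space UNIV) (\<epsilon> i) = uniform_count_measure UNIV"
  shows "prob (sample \<epsilon> n -` E \<inter> space M) = card {X \<in> E. length X = n} / 2 ^ n"
proof -
  have meas: "sample \<epsilon> n \<in> measurable M (count_space UNIV)"
    using indep by (intro sample_measurable) (auto simp: indep_vars_def2)
  have fin: "finite {X \<in> E. length X = n}"
    by (rule finite_subset[OF _ finite_letter_lists[of n]]) auto
  have "sample \<epsilon> n -` E \<inter> space M = (\<Union>x\<in>{X \<in> E. length X = n}. sample \<epsilon> n -` {x} \<inter> space M)"
    by (auto simp: length_sample)
  also have "prob \<dots> = (\<Sum>x | x \<in> E \<and> length x = n. prob (sample \<epsilon> n -` {x} \<inter> space M))"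
    using fin meas
    by (intro finite_measure_finite_Union) (auto simp: disjoint_family_on_def)
  also have "\<dots> = (\<Sum>x | x \<in> E \<and> length x = n. (1 / 2) ^ n)"
    using assms by (intro sum.cong refl prob_sample_eq) auto
  finally show ?thesis by (simp add: power_one_over)
qed

end

theorem theorem1:
  fixes A B :: "letter list" and l n :: nat
    and M :: "'a measure" and \<epsilon> :: "nat \<Rightarrow> 'a \<Rightarrow> letter"
  assumes "l \<ge> 1" and "length A = l" and "length B = l"
    and "n \<ge> 1"
    and "prob_space M"
    and "prob_space.indep_vars M (\<lambda>_. count_space UNIV) \<epsilon> {1..n}"
    and "\<And>i. i \<in> {1..n} \<Longrightarrow> distr M (count_space UNIV) (\<epsilon> i) = uniform_count_measure UNIV"
  shows "(Cor A A = Cor B B \<longleftrightarrow> correlation A A = correlation B B) \<and>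
    (Cor A A = Cor B B \<longrightarrow>
      distr M (count_space UNIV)
        (\<lambda>\<omega>. (occ_count A (sample \<epsilon> n \<omega>), occ_count B (sample \<epsilon> n \<omega>))) =
      distr M (count_space UNIV)
        (\<lambda>\<omega>. (occ_count B (sample \<epsilon> n \<omega>), occ_count A (sample \<epsilon> n \<omega>))) \<and>
      \<P>(\<omega> in M. occ_count B (sample \<epsilon> n \<omega>) > occ_count A (sample \<epsilon> n \<omega>)) =
      \<P>(\<omega> in M. occ_count A (sample \<epsilon> n \<omega>) > occ_count B (sample \<epsilon> n \<omega>)))"
proof (intro conjI impI)
  show "Cor A A = Cor B B \<longleftrightarrow> correlation A A = correlation B B"
    by (rule Cor_eq_iff_correlation_eq)
next
  assume Cor: "Cor A A = Cor B B"
  interpret prob_space M by fact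
  define pair where "pair A B \<omega> = (occ_count A (sample \<epsilon> n \<omega>), occ_count B (sample \<epsilon> n \<omega>))" for A B \<omega>
  have "sample \<epsilon> n \<in> measurable M (count_space UNIV)"
    using assms(6) by (intro sample_measurable) (auto simp: indep_vars_def2)
  then have meas: "pair A B \<in> measurable M (count_space UNIV)" for A B
    unfolding pair_def by (rule measurable_compose) simp
  have prob: "prob (pair A B -` {(a, b)} \<inter> space M) =
      card {X. length X = n \<and> occ_count A X = a \<and> occ_count B X = b} / 2 ^ n" for A B a b
  proof -
    have "pair A B -` {(a, b)} \<inter> space M =
        sample \<epsilon> n -` {X. occ_count A X = a \<and> occ_count B X = b} \<inter> space M"
      by (auto simp: pair_def)
    then show ?thesis
      using prob_sample_in[OF assms(4,6,7), of "{X. occ_count A X = a \<and> occ_count B X = b}"]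
      by (simp add: conj_ac del: vimage_Collect_eq)
  qed
  have distr_eq: "distr M (count_space UNIV) (pair A B) = distr M (count_space UNIV) (pair B A)"
  \<comment> \<open>Pairs of naturals form a countable set, so comparing the two laws on singletons
    suffices.\<close>
  proof (rule measure_eqI_countable[of _ UNIV])
    fix z :: "nat \<times> nat"
    obtain a b where z: "z = (a, b)" by fastforce
    show "emeasure (distr M (count_space UNIV) (pair A B)) {z} =
        emeasure (distr M (count_space UNIV) (pair B A)) {z}"
      by (simp add: z emeasure_distr[OF meas] emeasure_eq_measure prob
          card_occ_count_symmetric[OF assms(2,3) Cor])
  qed auto
  then show "distr M (count_space UNIV)
        (\<lambda>\<omega>. (occ_count A (sample \<epsilon> n \<omega>), occ_count B (sample \<epsilon> n \<omega>))) =
      distr M (count_space UNIV)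
        (\<lambda>\<omega>. (occ_count B (sample \<epsilon> n \<omega>), occ_count A (sample \<epsilon> n \<omega>)))"
    by (simp add: pair_def[abs_def])
  \<comment> \<open>The same set of pairs encodes a win of \<open>B\<close> under the law of
    \<open>pair A B\<close> and a win of \<open>A\<close> under that of
    \<open>pair B A\<close>.\<close>
  have "measure (distr M (count_space UNIV) (pair A B)) {(a, b). b > a} =
      measure (distr M (count_space UNIV) (pair B A)) {(a, b). b > a}"
    by (simp add: distr_eq)
  then show "\<P>(\<omega> in M. occ_count B (sample \<epsilon> n \<omega>) > occ_count A (sample \<epsilon> n \<omega>)) =
      \<P>(\<omega> in M. occ_count A (sample \<epsilon> n \<omega>) > occ_count B (sample \<epsilon> n \<omega>))"
    by (simp add: measure_distr[OF meas] pair_def vimage_def Int_def conj_commute)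
qed

end
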